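(* Let $\Delta$ be a $(d-1)$-dimensional simplicial complex. Then $\Delta$ has weak Property E if and only if for every $0\leq k\leq d$ we have $$h_k-h_{d-k}=(-1)^k \binom{d}{k}\left(\tilde{\chi}(S^{d-1})-\tilde{\chi}(\Delta) \right).$$ In particular, $\Delta$ has Property E if and only if for every $0\leq k\leq d$ we have $h_k=h_{d-k}$.
   Context: Simplicial complexes are finite abstract simplicial complexes, and the empty face is counted as a face. For a $(d-1)$-dimensional simplicial complex $\Delta$, let $f_i$ be the number of $i$-dimensional faces, with $f_{-1}=1$ (the empty face). The $e$-vector $(e_0,\dots,e_d)$ of $\Delta$ is the vector of coefficients of $\sum_{i=0}^d f_{i-1}(t-1)^i=\sum_{k=0}^d e_k t^k$, i.e. $e_k=\sum_{i=k}^d(-1)^{i-k}\binom{i}{k}f_{i-1}$. The $h$-vector $(h_0,\dots,h_d)$ is given by $h_k=\sum_{i=0}^k(-1)^{k-i}\binom{d-i}{k-i}f_{i-1}$. $\Delta$ has Property E if $e_k=(-1)^{d-k}f_{k-1}$ for every $0\le k\le d$; $\Delta$ has weak Property E if these equalities hold for every $1\le k\le d$. The ordinary (unreduced) Euler characteristic, ignoring the empty face, is denoted $\tilde{\chi}(\Delta)=\sum_{i=0}^{d-1}(-1)^i f_i$, and $\tilde{\chi}(S^{d-1})=1+(-1)^{d-1}$. *)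

theory Defs
  imports "HOL-Computational_Algebra.Polynomial"
begin

definition simplicial_complex :: "'a set set \<Rightarrow> bool" where
  "simplicial_complex \<Delta> \<longleftrightarrow>
     finite \<Delta> \<and> {} \<in> \<Delta> \<and> (\<forall>F\<in>\<Delta>. finite F \<and> (\<forall>G. G \<subseteq> F \<longrightarrow> G \<in> \<Delta>))"

definition face_dim :: "'a set \<Rightarrow> int" where
  "face_dim F = int (card F) - 1"

definition complex_dim :: "'a set set \<Rightarrow> int" where
  "complex_dim \<Delta> = Max (face_dim ` \<Delta>)"

definition f_num :: "'a set set \<Rightarrow> int \<Rightarrow> nat" where
  "f_num \<Delta> i = card {F \<in> \<Delta>. face_dim F = i}"

text \<open>For a complex of dimension \<open>d - 1\<close> this is the number \<open>d\<close>. It is a natural number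
  because the dimension is at least \<open>-1\<close>, with equality for the complex \<open>{{}}\<close>.\<close>

definition complex_rank :: "'a set set \<Rightarrow> nat" where
  "complex_rank \<Delta> = nat (complex_dim \<Delta> + 1)"

definition e_poly :: "'a set set \<Rightarrow> int poly" where
  "e_poly \<Delta> = (\<Sum>i\<le>complex_rank \<Delta>. smult (int (f_num \<Delta> (int i - 1))) ([:-1, 1:] ^ i))"

definition e_num :: "'a set set \<Rightarrow> nat \<Rightarrow> int" where
  "e_num \<Delta> k = coeff (e_poly \<Delta>) k"

definition h_num :: "'a set set \<Rightarrow> nat \<Rightarrow> int" where
  "h_num \<Delta> k =
     (\<Sum>i=0..k. (-1) ^ (k - i) * int ((complex_rank \<Delta> - i) choose (k - i)) * int (f_num \<Delta> (int i - 1)))"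

definition weak_property_E :: "'a set set \<Rightarrow> bool" where
  "weak_property_E \<Delta> \<longleftrightarrow>
     (\<forall>k\<in>{1..complex_rank \<Delta>}.
        e_num \<Delta> k = (-1) ^ (complex_rank \<Delta> - k) * int (f_num \<Delta> (int k - 1)))"

definition property_E :: "'a set set \<Rightarrow> bool" where
  "property_E \<Delta> \<longleftrightarrow>
     (\<forall>k\<in>{0..complex_rank \<Delta>}.
        e_num \<Delta> k = (-1) ^ (complex_rank \<Delta> - k) * int (f_num \<Delta> (int k - 1)))"

text \<open>The unreduced Euler characteristic: the empty face does not contribute.\<close>

definition euler_char :: "'a set set \<Rightarrow> int" where
  "euler_char \<Delta> = (\<Sum>i<complex_rank \<Delta>. (-1) ^ i * int (f_num \<Delta> (int i)))"

text \<open>The value \<open>1 + (-1)\<^sup>n\<close> for the sphere of dimension \<open>n\<close>. The exponent is an integer so that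
  the empty sphere, of dimension \<open>-1\<close>, has Euler characteristic \<open>0\<close>.\<close>

definition sphere_euler_char :: "int \<Rightarrow> int" where
  "sphere_euler_char n = 1 + (if even n then 1 else -1)"

lemma f_num_empty_face:
  assumes "simplicial_complex \<Delta>"
  shows "f_num \<Delta> (-1) = 1"
proof -
  have "{F \<in> \<Delta>. face_dim F = -1} = {{}}"
    using assms by (auto simp: simplicial_complex_def face_dim_def)
  then show ?thesis
    by (simp add: f_num_def)
qed

lemma e_num_eq_sum:
  "e_num \<Delta> k =
     (\<Sum>i=k..complex_rank \<Delta>. (-1) ^ (i - k) * int (i choose k) * int (f_num \<Delta> (int i - 1)))"
proof -
  have c: "coeff ([:-1, 1:] ^ i :: int poly) k = int (i choose k) * (-1) ^ (i - k)" for i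
  proof (cases "k \<le> i")
    case True
    then show ?thesis
      by (simp add: coeff_linear_poly_power)
  next
    case False
    moreover have "degree ([:-1, 1:] ^ i :: int poly) \<le> i"
      by (rule order_trans[OF degree_power_le]) simp
    ultimately show ?thesis
      by (simp add: coeff_eq_0 binomial_eq_0)
  qed
  have "e_num \<Delta> k =
      (\<Sum>i\<le>complex_rank \<Delta>. (-1) ^ (i - k) * int (i choose k) * int (f_num \<Delta> (int i - 1)))"
    by (simp add: e_num_def e_poly_def coeff_sum c mult_ac)
  also have "\<dots> =
      (\<Sum>i=k..complex_rank \<Delta>. (-1) ^ (i - k) * int (i choose k) * int (f_num \<Delta> (int i - 1)))"
    by (rule sum.mono_neutral_right) (auto simp: binomial_eq_0)
  finally show ?thesis .
qed

end

theory Submission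
  imports Defs
begin

text \<open>Put \<open>a\<^sub>i = f\<^bsub>i-1\<^esub>\<close> and \<open>F(t) = \<Sum> a\<^sub>i t\<^sup>i\<close>. Up to the sign \<open>(-1)\<^sup>d\<close>, Property E is the symmetry
  of \<open>F\<close> under \<open>t \<mapsto> -1 - t\<close>, and \<open>h\<^sub>k = h\<^bsub>d-k\<^esub>\<close> is the symmetry of
  \<open>h(t) = (1 - t)\<^sup>d F(t/(1 - t))\<close> under \<open>h(t) \<mapsto> t\<^sup>d h(1/t)\<close>. The change of variable relating \<open>F\<close>
  and \<open>h\<close> carries the failure of one symmetry to the failure of the other. With
  \<open>D\<^sub>j = e\<^sub>j - (-1)\<^bsup>d-j\<^esup> f\<^bsub>j-1\<^esub>\<close> the relation is
  \<open>h(t) - t\<^sup>d h(1/t) = \<Sum> D\<^sub>j (1 - t)\<^bsup>d-j\<^esup>\<close>, summed over \<open>0 \<le> j \<le> d\<close>,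
  which is easiest to see after the involution \<open>t \<mapsto> 1 - t\<close>, when the powers of \<open>1 - t\<close> on the
  right become powers of \<open>t\<close> and the \<open>D\<^sub>j\<close> can be read off as coefficients
  (\<open>coeff_pcompose_asymmetry_poly\<close>).

  The powers of \<open>1 - t\<close> are linearly independent. So weak Property E, the vanishing of \<open>D\<^sub>j\<close> for
  \<open>j \<ge> 1\<close>, says that the left side is \<open>D\<^sub>0 (1 - t)\<^sup>d\<close>, and Property E says that it vanishes.
  Comparing coefficients of \<open>t\<^sup>k\<close> gives both equivalences, since \<open>D\<^sub>0\<close> is the difference of the two
  Euler characteristics (\<open>e_defect_0\<close>).\<close>

lemma coeff_linear_power:
  fixes a b :: "'a :: comm_ring_1"
  shows "coeff ([:a, b:] ^ n) k = of_nat (n choose k) * b ^ k * a ^ (n - k)"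
proof (cases "k \<le> n")
  case True
  then show ?thesis
    by (simp add: coeff_linear_poly_power)
next
  case False
  moreover have "degree ([:a, b:] ^ n) \<le> n"
    by (rule order_trans[OF degree_power_le]) simp
  ultimately show ?thesis
    by (simp add: coeff_eq_0 binomial_eq_0)
qed

lemma pcompose_power: "pcompose (p ^ n) q = pcompose p q ^ n"
  by (induction n) (simp_all add: pcompose_mult pcompose_1)

text \<open>If \<open>a\<close> is the \<open>f\<close>-vector with its index shifted by one, the first summands make up \<open>h(t)\<close> and
  the second ones its reversal \<open>t\<^sup>d h(1/t)\<close>.\<close>

definition asymmetry_poly :: "(nat \<Rightarrow> int) \<Rightarrow> nat \<Rightarrow> int poly" where
  "asymmetry_poly a d =
     (\<Sum>i\<le>d. smult (a i) (monom 1 i * [:1, -1:] ^ (d - i) - [:-1, 1:] ^ (d - i)))"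

lemma coeff_asymmetry_poly:
  assumes "k \<le> d"
  shows "coeff (asymmetry_poly a d) k =
    (\<Sum>i=0..k. (-1) ^ (k - i) * int ((d - i) choose (k - i)) * a i)
    - (\<Sum>i=0..d - k. (-1) ^ (d - k - i) * int ((d - i) choose (d - k - i)) * a i)"
proof -
  have "(\<Sum>i\<le>d. a i * coeff (monom 1 i * [:1, -1:] ^ (d - i)) k) =
      (\<Sum>i=0..k. a i * coeff (monom 1 i * [:1, -1:] ^ (d - i)) k)"
    using assms by (intro sum.mono_neutral_right) (auto simp: coeff_monom_mult)
  also have "\<dots> = (\<Sum>i=0..k. (-1) ^ (k - i) * int ((d - i) choose (k - i)) * a i)"
    by (rule sum.cong) (auto simp: coeff_monom_mult coeff_linear_power)
  finally have h: "(\<Sum>i\<le>d. a i * coeff (monom 1 i * [:1, -1:] ^ (d - i)) k) =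
      (\<Sum>i=0..k. (-1) ^ (k - i) * int ((d - i) choose (k - i)) * a i)" .
  have "(\<Sum>i\<le>d. a i * coeff ([:-1, 1:] ^ (d - i)) k) =
      (\<Sum>i=0..d - k. a i * coeff ([:-1, 1:] ^ (d - i)) k)"
    using assms by (intro sum.mono_neutral_right) (auto simp: coeff_linear_power binomial_eq_0)
  also have "\<dots> = (\<Sum>i=0..d - k. (-1) ^ (d - k - i) * int ((d - i) choose (d - k - i)) * a i)"
  proof (rule sum.cong)
    fix i assume "i \<in> {0..d - k}"
    then have "(d - i) choose k = (d - i) choose (d - k - i)"
      using assms binomial_symmetric[of k "d - i"] by (auto simp: add.commute)
    then show "a i * coeff ([:-1, 1:] ^ (d - i)) k =
        (-1) ^ (d - k - i) * int ((d - i) choose (d - k - i)) * a i"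
      by (simp add: coeff_linear_power add.commute)
  qed simp
  finally show ?thesis
    using h by (simp add: asymmetry_poly_def coeff_sum right_diff_distrib sum_subtractf)
qed

lemma degree_asymmetry_poly: "degree (asymmetry_poly a d) \<le> d"
  unfolding asymmetry_poly_def
proof (intro degree_sum_le order_trans[OF degree_smult_le] degree_diff_le)
  fix i assume "i \<in> {..d}"
  then have "degree (monom (1::int) i) + degree ([:1, -1::int:] ^ (d - i)) \<le> d"
    by (simp add: degree_monom_eq degree_power_eq)
  then show "degree (monom 1 i * [:1, -1::int:] ^ (d - i)) \<le> d"
    by (rule order_trans[OF degree_mult_le])
qed (simp_all add: degree_power_eq)

text \<open>Under \<open>t \<mapsto> 1 - t\<close> the summands \<open>a\<^sub>i t\<^sup>i (1 - t)\<^bsup>d-i\<^esup>\<close> of \<open>h\<close> turn into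
  \<open>a\<^sub>i t\<^bsup>d-i\<^esup> (1 - t)\<^sup>i = t\<^sup>d a\<^sub>i (1/t - 1)\<^sup>i\<close>, whose sum is \<open>\<Sum> a\<^sub>i (t - 1)\<^sup>i\<close> with its
  coefficients in reverse order, and the summands \<open>a\<^sub>i (t - 1)\<^bsup>d-i\<^esup>\<close> of the reversal turn into the
  monomials \<open>a\<^sub>i (-t)\<^bsup>d-i\<^esup>\<close>. These give the two sides of the equations of Property E.\<close>

lemma coeff_pcompose_asymmetry_poly:
  assumes "j \<le> d"
  shows "coeff (pcompose (asymmetry_poly a d) [:1, -1:]) (d - j) =
    (\<Sum>i=j..d. (-1) ^ (i - j) * int (i choose j) * a i) - (-1) ^ (d - j) * a j"
proof -
  have monom: "(monom 1 n :: int poly) = [:0, 1:] ^ n" for n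
    by (simp add: monom_altdef)
  have "pcompose (asymmetry_poly a d) [:1, -1:] =
      (\<Sum>i\<le>d. smult (a i) ([:1, -1:] ^ i * monom 1 (d - i) - [:0, -1:] ^ (d - i)))"
    unfolding asymmetry_poly_def
    by (simp add: pcompose_sum pcompose_smult pcompose_diff pcompose_mult pcompose_power
        pcompose_pCons monom)
  then have "coeff (pcompose (asymmetry_poly a d) [:1, -1:]) (d - j) =
      (\<Sum>i\<le>d. a i * coeff (monom 1 (d - i) * [:1, -1:] ^ i) (d - j))
      - (\<Sum>i\<le>d. a i * coeff ([:0, -1:] ^ (d - i)) (d - j))"
    by (simp add: coeff_sum right_diff_distrib sum_subtractf mult.commute)
  also have "(\<Sum>i\<le>d. a i * coeff (monom 1 (d - i) * [:1, -1:] ^ i) (d - j)) =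
      (\<Sum>i=j..d. a i * coeff (monom 1 (d - i) * [:1, -1:] ^ i) (d - j))"
    using assms by (intro sum.mono_neutral_right) (auto simp: coeff_monom_mult)
  also have "\<dots> = (\<Sum>i=j..d. (-1) ^ (i - j) * int (i choose j) * a i)"
  proof (rule sum.cong)
    fix i assume i: "i \<in> {j..d}"
    then have "d - j - (d - i) = i - j" "i choose (i - j) = i choose j"
      using binomial_symmetric[of j i] by auto
    with i show "a i * coeff (monom 1 (d - i) * [:1, -1:] ^ i) (d - j) =
        (-1) ^ (i - j) * int (i choose j) * a i"
      by (auto simp: coeff_monom_mult coeff_linear_power)
  qed simp
  also have "(\<Sum>i\<le>d. a i * coeff ([:0, -1:] ^ (d - i)) (d - j)) =
      (\<Sum>i\<in>{j}. a i * coeff ([:0, -1:] ^ (d - i)) (d - j))"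
    using assms
    by (intro sum.mono_neutral_right) (auto simp: coeff_linear_power binomial_eq_0 power_0_left)
  also have "\<dots> = (-1) ^ (d - j) * a j"
    by (simp add: coeff_linear_power)
  finally show ?thesis .
qed

lemma poly_eq_iff_coeff_le:
  assumes "degree p \<le> d" "degree q \<le> d"
  shows "p = q \<longleftrightarrow> (\<forall>k\<le>d. coeff p k = coeff q k)"
proof
  assume "\<forall>k\<le>d. coeff p k = coeff q k"
  moreover have "coeff p k = coeff q k" if "k > d" for k
    using assms that by (simp add: coeff_eq_0)
  ultimately show "p = q"
    by (metis poly_eqI not_le)
qed simp

text \<open>This is where linear independence of the powers of \<open>1 - t\<close> enters, in the form that
  \<open>t \<mapsto> 1 - t\<close> is an involution, hence injective on polynomials.\<close>

lemma pcompose_one_minus_eq_monom_iff: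
  fixes q :: "int poly"
  shows "pcompose q [:1, -1:] = monom c d \<longleftrightarrow> q = smult c ([:1, -1:] ^ d)"
proof
  assume "pcompose q [:1, -1:] = monom c d"
  then have "pcompose (pcompose q [:1, -1:]) [:1, -1:] = pcompose (monom c d) [:1, -1:]"
    by simp
  then show "q = smult c ([:1, -1:] ^ d)"
    by (simp add: pcompose_assoc[symmetric] pcompose_pCons monom_altdef pcompose_smult
        pcompose_power)
next
  assume "q = smult c ([:1, -1:] ^ d)"
  then show "pcompose q [:1, -1:] = monom c d"
    by (simp add: pcompose_pCons monom_altdef pcompose_smult pcompose_power)
qed

text \<open>Transport of the defects: those of Property E are the coefficients on the left (in reverse
  order), and those of the symmetry of the \<open>h\<close>-vector are the coefficients of the asymmetry
  polynomial itself.\<close>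

lemma asymmetry_coeff_iff:
  "(\<forall>j\<le>d. coeff (pcompose (asymmetry_poly a d) [:1, -1:]) (d - j) = (if j = 0 then c else 0)) \<longleftrightarrow>
   (\<forall>k\<le>d. coeff (asymmetry_poly a d) k = (-1) ^ k * int (d choose k) * c)"
proof -
  let ?q = "asymmetry_poly a d" and ?r = "pcompose (asymmetry_poly a d) [:1, -1:]"
  have "(\<forall>j\<le>d. coeff ?r (d - j) = (if j = 0 then c else 0)) \<longleftrightarrow>
      (\<forall>k\<le>d. coeff ?r k = coeff (monom c d) k)"
  proof safe
    fix k assume "\<forall>j\<le>d. coeff ?r (d - j) = (if j = 0 then c else 0)" "k \<le> d"
    then show "coeff ?r k = coeff (monom c d) k"
      by (drule_tac spec[of _ "d - k"]) auto
  qed auto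
  also have "\<dots> \<longleftrightarrow> ?r = monom c d"
    using degree_asymmetry_poly[of a d]
    by (intro poly_eq_iff_coeff_le[symmetric]) (auto simp: degree_pcompose degree_monom_le)
  also have "\<dots> \<longleftrightarrow> ?q = smult c ([:1, -1:] ^ d)"
    by (rule pcompose_one_minus_eq_monom_iff)
  also have "\<dots> \<longleftrightarrow> (\<forall>k\<le>d. coeff ?q k = coeff (smult c ([:1, -1:] ^ d)) k)"
    by (intro poly_eq_iff_coeff_le degree_asymmetry_poly order_trans[OF degree_smult_le])
      (simp add: degree_power_eq)
  finally show ?thesis
    by (simp add: coeff_linear_power mult_ac)
qed

text \<open>The equation of Property E at \<open>k = 0\<close> is Euler's relation: \<open>e\<^sub>0\<close> is the alternating sum of the
  face numbers, in which the empty face contributes \<open>1\<close> and the others \<open>-\<chi>\<close>.\<close>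

lemma e_defect_0:
  assumes "simplicial_complex \<Delta>" and d: "complex_rank \<Delta> = d"
  shows "e_num \<Delta> 0 - (-1) ^ d * int (f_num \<Delta> (-1)) =
    sphere_euler_char (int d - 1) - euler_char \<Delta>"
proof -
  have "e_num \<Delta> 0 = (\<Sum>i<Suc d. (-1) ^ i * int (f_num \<Delta> (int i - 1)))"
    by (simp add: e_num_eq_sum d atLeast0AtMost lessThan_Suc_atMost)
  also have "\<dots> = 1 - euler_char \<Delta>"
    by (subst sum.lessThan_Suc_shift)
      (simp add: euler_char_def d f_num_empty_face[OF assms(1)] sum_negf)
  finally show ?thesis
    by (simp add: sphere_euler_char_def f_num_empty_face[OF assms(1)])
qed

theorem theorem3:
  fixes \<Delta> :: "'a set set" and d :: nat
  assumes "simplicial_complex \<Delta>"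
    and "complex_dim \<Delta> = int d - 1"
  shows "(weak_property_E \<Delta> \<longleftrightarrow>
           (\<forall>k\<in>{0..d}. h_num \<Delta> k - h_num \<Delta> (d - k) =
              (-1) ^ k * int (d choose k) * (sphere_euler_char (int d - 1) - euler_char \<Delta>)))
       \<and> (property_E \<Delta> \<longleftrightarrow> (\<forall>k\<in>{0..d}. h_num \<Delta> k = h_num \<Delta> (d - k)))"
proof -
  have d: "complex_rank \<Delta> = d"
    using assms(2) by (simp add: complex_rank_def)
  define a where "a i = int (f_num \<Delta> (int i - 1))" for i
  define c where "c = sphere_euler_char (int d - 1) - euler_char \<Delta>"
  define D where "D j = e_num \<Delta> j - (-1) ^ (d - j) * a j" for j
  have D0: "D 0 = c"
    using e_defect_0[OF assms(1) d] by (simp add: D_def a_def c_def)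
  have D: "coeff (pcompose (asymmetry_poly a d) [:1, -1:]) (d - j) = D j" if "j \<le> d" for j
    using that by (simp add: coeff_pcompose_asymmetry_poly D_def e_num_eq_sum d a_def)
  have h: "coeff (asymmetry_poly a d) k = h_num \<Delta> k - h_num \<Delta> (d - k)" if "k \<le> d" for k
    using that by (simp add: coeff_asymmetry_poly h_num_def d a_def)
  have transport: "(\<forall>j\<le>d. D j = (if j = 0 then x else 0)) \<longleftrightarrow>
      (\<forall>k\<le>d. h_num \<Delta> k - h_num \<Delta> (d - k) = (-1) ^ k * int (d choose k) * x)" for x
    using asymmetry_coeff_iff[of d a x] by (simp add: D h)
  have "weak_property_E \<Delta> \<longleftrightarrow> (\<forall>j\<le>d. D j = (if j = 0 then c else 0))"
    using D0 by (auto simp: weak_property_E_def d D_def a_def)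
  then have "weak_property_E \<Delta> \<longleftrightarrow>
      (\<forall>k\<le>d. h_num \<Delta> k - h_num \<Delta> (d - k) = (-1) ^ k * int (d choose k) * c)"
    by (simp only: transport)
  moreover have "property_E \<Delta> \<longleftrightarrow> (\<forall>j\<le>d. D j = 0)"
    by (auto simp: property_E_def d D_def a_def)
  then have "property_E \<Delta> \<longleftrightarrow> (\<forall>k\<le>d. h_num \<Delta> k = h_num \<Delta> (d - k))"
    using transport[of 0] by simp
  ultimately show ?thesis
    by (simp add: c_def Ball_def)
qed

end
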